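(* Let $n\in\mathbb{P}$, $p\in(0,1)$, $q=1-p$, and let $G$ be an Erdős–Rényi random graph on vertex set $[n]$ with edge probability $p$. Let $|\chi_G(-1)|$ denote the number of acyclic orientations of $G$. Then $$\mathbb{E}\big[|\chi_G(-1)|\big]=q^{\binom n2}\sum_{\mathbf{a}\in\mathrm{Park}_{[n]}}\Big(\frac1q\Big)^{\mathrm{Area}(\mathbf{a})}p^{|\mathrm{supp}(\mathbf{a})|}.$$
   Context: A parking function of $[n]$ is a vector $\mathbf{a}\in\mathbb{N}^{[n]}$ such that, whenever $\sigma$ is a permutation with $a_{\sigma(1)}\le\cdots\le a_{\sigma(n)}$, one has $a_{\sigma(i)}\le i-1$ for all $i$; $\mathrm{Park}_{[n]}$ is the set of these. $\mathrm{Area}(\mathbf{a})=a_1+\dots+a_n$ and $\mathrm{supp}(\mathbf{a})=\{i:a_i>0\}$. An acyclic orientation orients every edge with no directed cycle. *)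

theory Defs
  imports "HOL-Probability.Probability" "HOL-Combinatorics.Permutations"
begin

text \<open>Vectors indexed by \<open>[n] = {1..n}\<close> are extensional functions, so that distinct
  functions are distinct vectors.\<close>

definition parking_functions :: "nat \<Rightarrow> (nat \<Rightarrow> nat) set" where
  "parking_functions n =
     {a \<in> {1..n} \<rightarrow>\<^sub>E UNIV.
        \<forall>\<sigma>. \<sigma> permutes {1..n} \<and> mono_on {1..n} (\<lambda>i. a (\<sigma> i))
            \<longrightarrow> (\<forall>i\<in>{1..n}. a (\<sigma> i) \<le> i - 1)}"

definition area :: "nat \<Rightarrow> (nat \<Rightarrow> nat) \<Rightarrow> nat" where
  "area n a = (\<Sum>i\<in>{1..n}. a i)"

definition supp :: "nat \<Rightarrow> (nat \<Rightarrow> nat) \<Rightarrow> nat set" where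
  "supp n a = {i \<in> {1..n}. a i > 0}"

lemma ex_sorting_permutation:
  fixes a :: "nat \<Rightarrow> nat"
  shows "\<exists>\<sigma>. \<sigma> permutes {1..n} \<and> mono_on {1..n} (\<lambda>i. a (\<sigma> i))"
proof -
  define xs where "xs = sort_key a [1..<Suc n]"
  define \<sigma> where "\<sigma> i = (if i \<in> {1..n} then xs ! (i - 1) else i)" for i
  have len: "length xs = n" and dist: "distinct xs" and set: "set xs = {1..n}"
    by (auto simp: xs_def)
  have sorted: "sorted (map a xs)"
    by (simp add: xs_def)
  have "inj_on \<sigma> {1..n}"
  proof (rule inj_onI)
    fix i j assume ij: "i \<in> {1..n}" "j \<in> {1..n}" "\<sigma> i = \<sigma> j"
    then have "xs ! (i - 1) = xs ! (j - 1)" "i - 1 < length xs" "j - 1 < length xs"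
      using len by (auto simp: \<sigma>_def)
    then have "i - 1 = j - 1"
      using dist nth_eq_iff_index_eq by blast
    with ij show "i = j" by auto
  qed
  moreover have "\<sigma> ` {1..n} \<subseteq> {1..n}"
  proof
    fix y assume "y \<in> \<sigma> ` {1..n}"
    then obtain i where i: "i \<in> {1..n}" "y = xs ! (i - 1)"
      by (auto simp: \<sigma>_def)
    then have "i - 1 < length xs"
      using len by auto
    with i set show "y \<in> {1..n}"
      using nth_mem by blast
  qed
  ultimately have "bij_betw \<sigma> {1..n} {1..n}"
    by (simp add: bij_betw_def endo_inj_surj)
  then have "\<sigma> permutes {1..n}"
    by (rule bij_imp_permutes) (auto simp: \<sigma>_def)
  moreover have "mono_on {1..n} (\<lambda>i. a (\<sigma> i))"
  proof (rule mono_onI)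
    fix i j assume "i \<in> {1..n}" "j \<in> {1..n}" "i \<le> j"
    then show "a (\<sigma> i) \<le> a (\<sigma> j)"
      using sorted_nth_mono[OF sorted, of "i - 1" "j - 1"] len by (auto simp: \<sigma>_def)
  qed
  ultimately show ?thesis by blast
qed

lemma finite_parking_functions: "finite (parking_functions n)"
proof (rule finite_subset)
  show "parking_functions n \<subseteq> {1..n} \<rightarrow>\<^sub>E {..n}"
  proof
    fix a assume a: "a \<in> parking_functions n"
    obtain \<sigma> where \<sigma>: "\<sigma> permutes {1..n}" "mono_on {1..n} (\<lambda>i. a (\<sigma> i))"
      using ex_sorting_permutation by blast
    have le: "a (\<sigma> i) \<le> n" if i: "i \<in> {1..n}" for i
    proof -
      have "\<forall>i\<in>{1..n}. a (\<sigma> i) \<le> i - 1"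
        using a \<sigma> unfolding parking_functions_def by blast
      with i have "a (\<sigma> i) \<le> i - 1" by blast
      with i show ?thesis by auto
    qed
    have "a j \<le> n" if "j \<in> {1..n}" for j
    proof -
      have "j \<in> \<sigma> ` {1..n}"
        using that by (simp only: permutes_image[OF \<sigma>(1)])
      then show ?thesis using le by blast
    qed
    with a show "a \<in> {1..n} \<rightarrow>\<^sub>E {..n}"
      by (auto simp: parking_functions_def PiE_def)
  qed
  show "finite ({1..n} \<rightarrow>\<^sub>E {..n})"
    by (intro finite_PiE) auto
qed

text \<open>A simple graph on a fixed vertex set is given by its set of edges, which are
  two-element sets of vertices; an orientation is the set of its arcs.\<close>

definition all_edges :: "nat \<Rightarrow> nat set set" where
  "all_edges n = {e. e \<subseteq> {1..n} \<and> card e = 2}"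

definition is_orientation :: "'a set set \<Rightarrow> ('a \<times> 'a) set \<Rightarrow> bool" where
  "is_orientation E D \<longleftrightarrow>
     (\<forall>u v. (u, v) \<in> D \<longrightarrow> {u, v} \<in> E) \<and>
     (\<forall>u v. {u, v} \<in> E \<longrightarrow> ((u, v) \<in> D \<longleftrightarrow> (v, u) \<notin> D))"

definition acyclic_orientations :: "'a set set \<Rightarrow> ('a \<times> 'a) set set" where
  "acyclic_orientations E = {D. is_orientation E D \<and> acyclic D}"

lemma finite_all_edges: "finite (all_edges n)"
  by (rule finite_subset[of _ "Pow {1..n}"]) (auto simp: all_edges_def)

lemma finite_acyclic_orientations:
  assumes "E \<subseteq> all_edges n"
  shows "finite (acyclic_orientations E)"
proof (rule finite_subset)
  show "acyclic_orientations E \<subseteq> Pow ({1..n} \<times> {1..n})"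
  proof (intro subsetI PowI)
    fix D x assume D: "D \<in> acyclic_orientations E" and x: "x \<in> D"
    obtain u v where uv: "x = (u, v)" by (cases x)
    have "{u, v} \<in> E"
      using D x uv by (simp add: acyclic_orientations_def is_orientation_def)
    with assms have "{u, v} \<in> all_edges n" by (rule subsetD)
    then have "{u, v} \<subseteq> {1..n}" by (simp add: all_edges_def)
    then show "x \<in> {1..n} \<times> {1..n}"
      by (simp add: uv)
  qed
qed simp

definition erdos_renyi :: "nat \<Rightarrow> real \<Rightarrow> nat set set pmf" where
  "erdos_renyi n p =
     map_pmf (\<lambda>f. {e \<in> all_edges n. f e})
       (Pi_pmf (all_edges n) False (\<lambda>_. bernoulli_pmf p))"

end

theory Submission
  imports Defs
begin

text \<open>
  Put \<open>x = p / q\<close>, so \<open>1 / q = 1 + x\<close>. The expectation is \<open>q ^ (n choose 2)\<close> times the sum of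
  \<open>x ^ card D\<close> over all acyclic digraphs \<open>D\<close> on \<open>[n]\<close>. List the vertices of \<open>D\<close> in the topological
  order that always takes the least vertex all of whose in-neighbours are already listed, and let
  \<open>T v\<close> be the set of positions (counted from \<open>0\<close>) of the in-neighbours of \<open>v\<close>. Whether \<open>v\<close> may
  be listed at position \<open>k\<close> only depends on whether \<open>T v \<subseteq> {..<k}\<close>, so the order, and hence \<open>D\<close>,
  can be recovered from \<open>T\<close>. With \<open>a v\<close> the least \<open>k\<close> such that \<open>T v \<subseteq> {..<k}\<close>, the greedy
  procedure never gets stuck iff \<open>a\<close> is a parking function. Summing \<open>x ^ card (T v)\<close> over all
  \<open>T v\<close> with prescribed \<open>a v > 0\<close> gives \<open>x * (1 + x) ^ (a v - 1) = (1 / q) ^ a v * p\<close>.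
\<close>

section \<open>Greedy enumerations\<close>

text \<open>\<open>B v ys\<close> reads: \<open>v\<close> may be listed right after
  \<open>ys\<close>. The predicate sees the whole list because one instance below inspects its
  entries and the other only its length. \<open>Min\<close> of an empty set is unspecified, so the
  list is meaningful only while some candidate is left.\<close>

primrec greedy_list :: "'a::linorder set \<Rightarrow> ('a \<Rightarrow> 'a list \<Rightarrow> bool) \<Rightarrow> nat \<Rightarrow> 'a list" where
  "greedy_list V B 0 = []"
| "greedy_list V B (Suc k) =
     greedy_list V B k @ [Min {v \<in> V - set (greedy_list V B k). B v (greedy_list V B k)}]"

lemma length_greedy_list [simp]: "length (greedy_list V B k) = k"
  by (induction k) auto

lemma take_greedy_list: "k \<le> m \<Longrightarrow> take k (greedy_list V B m) = greedy_list V B k"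
proof (induction m)
  case (Suc m)
  then show ?case by (cases "k = Suc m") auto
qed auto

text \<open>Agreement is demanded only on the prefixes that the run with \<open>B\<close> visits.
  This matters because the two predicates compared later agree along one particular order, not on
  arbitrary lists.\<close>

lemma greedy_list_cong:
  assumes "\<And>k v. k < m \<Longrightarrow> v \<in> V \<Longrightarrow> B v (greedy_list V B k) = B' v (greedy_list V B k)"
  shows "greedy_list V B' m = greedy_list V B m"
  using assms
proof (induction m)
  case (Suc m)
  then have eq: "greedy_list V B' m = greedy_list V B m" by simp
  have "{v \<in> V - set (greedy_list V B m). B' v (greedy_list V B m)}
      = {v \<in> V - set (greedy_list V B m). B v (greedy_list V B m)}"
    using Suc.prems[of m] by auto
  then show ?case using eq by simp
qed simp

text \<open>Quantifying over all distinct lists instead of greedy prefixes makes the condition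
  independent of the tie-breaking rule, hence checkable without knowing the greedy order.\<close>

definition extendable :: "'a set \<Rightarrow> ('a \<Rightarrow> 'a list \<Rightarrow> bool) \<Rightarrow> bool" where
  "extendable V B \<longleftrightarrow>
     (\<forall>ys. distinct ys \<longrightarrow> set ys \<subset> V \<longrightarrow> (\<exists>v\<in>V - set ys. B v ys))"

lemma greedy_list_extendable:
  assumes "finite V" "extendable V B" "k \<le> card V"
  shows "distinct (greedy_list V B k) \<and> set (greedy_list V B k) \<subseteq> V \<and>
    (\<forall>j<k. B (greedy_list V B k ! j) (greedy_list V B j))"
  using assms(3)
proof (induction k)
  case (Suc k)
  let ?ys = "greedy_list V B k"
  let ?S = "{v \<in> V - set ?ys. B v ?ys}"
  have IH: "distinct ?ys" "set ?ys \<subseteq> V" "\<forall>j<k. B (?ys ! j) (greedy_list V B j)"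
    using Suc by auto
  have "card (set ?ys) = k" using IH by (simp add: distinct_card)
  then have "set ?ys \<subset> V" using IH Suc.prems by (metis Suc_n_not_le_n psubsetI)
  then have "?S \<noteq> {}" using assms(2) IH unfolding extendable_def by blast
  then have "Min ?S \<in> ?S" using assms(1) by (intro Min_in) auto
  then show ?case using IH by (auto simp: nth_append less_Suc_eq)
qed simp

definition greedy_order :: "'a::linorder set \<Rightarrow> ('a \<Rightarrow> 'a list \<Rightarrow> bool) \<Rightarrow> 'a list" where
  "greedy_order V B = greedy_list V B (card V)"

lemma greedy_order_props:
  assumes "finite V" "extendable V B"
  shows "length (greedy_order V B) = card V"
    and "distinct (greedy_order V B)"
    and "set (greedy_order V B) = V"
    and "\<And>j. j < card V \<Longrightarrow> B (greedy_order V B ! j) (take j (greedy_order V B))"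
proof -
  show len: "length (greedy_order V B) = card V" by (simp add: greedy_order_def)
  show d: "distinct (greedy_order V B)"
    using greedy_list_extendable[OF assms order_refl] by (simp add: greedy_order_def)
  have "set (greedy_order V B) \<subseteq> V"
    using greedy_list_extendable[OF assms order_refl] by (simp add: greedy_order_def)
  then show "set (greedy_order V B) = V"
    using assms(1) d len by (metis card_subset_eq distinct_card)
  show "B (greedy_order V B ! j) (take j (greedy_order V B))" if "j < card V" for j
    using greedy_list_extendable[OF assms order_refl] that
    by (simp add: greedy_order_def take_greedy_list)
qed

lemma greedy_order_cong:
  assumes "\<And>k v. k < card V \<Longrightarrow> v \<in> V \<Longrightarrow>
    B v (take k (greedy_order V B)) = B' v (take k (greedy_order V B))"
  shows "greedy_order V B' = greedy_order V B"
  unfolding greedy_order_def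
  by (rule greedy_list_cong) (use assms in \<open>simp add: greedy_order_def take_greedy_list\<close>)


section \<open>Acyclic digraphs and families of position sets\<close>

definition acyclic_digraphs :: "'a set \<Rightarrow> ('a \<times> 'a) set set" where
  "acyclic_digraphs V = {D. D \<subseteq> V \<times> V \<and> acyclic D}"

text \<open>At each position \<open>k\<close> at least \<open>k + 1\<close> vertices are eligible,
  so \<open>k\<close> listed vertices can never exhaust them. This is the counting form of the
  parking condition, with \<open>T v \<subseteq> {..<k}\<close> in place of
  \<open>a v \<le> k\<close>.\<close>

definition position_families :: "'a set \<Rightarrow> ('a \<Rightarrow> nat set) set" where
  "position_families V =
     {T \<in> V \<rightarrow>\<^sub>E UNIV. \<forall>k<card V. k < card {v \<in> V. T v \<subseteq> {..<k}}}"

definition parents_listed :: "('a \<times> 'a) set \<Rightarrow> 'a \<Rightarrow> 'a list \<Rightarrow> bool" where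
  "parents_listed D v ys \<longleftrightarrow> D\<inverse> `` {v} \<subseteq> set ys"

definition positions_listed :: "('a \<Rightarrow> nat set) \<Rightarrow> 'a \<Rightarrow> 'a list \<Rightarrow> bool" where
  "positions_listed T v ys \<longleftrightarrow> T v \<subseteq> {..<length ys}"

definition parent_positions :: "'a set \<Rightarrow> 'a list \<Rightarrow> ('a \<times> 'a) set \<Rightarrow> 'a \<Rightarrow> nat set" where
  "parent_positions V xs D = (\<lambda>v\<in>V. {j. j < length xs \<and> (xs ! j, v) \<in> D})"

definition digraph_of_positions :: "'a set \<Rightarrow> 'a list \<Rightarrow> ('a \<Rightarrow> nat set) \<Rightarrow> ('a \<times> 'a) set" where
  "digraph_of_positions V xs T = {(xs ! j, v) |j v. v \<in> V \<and> j \<in> T v}"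

section \<open>Neither greedy procedure gets stuck\<close>

lemma extendable_parents_listed:
  assumes "finite V" "D \<in> acyclic_digraphs V"
  shows "extendable V (parents_listed D)"
  unfolding extendable_def
proof (intro allI impI)
  fix ys assume "distinct ys" "set ys \<subset> V"
  have "finite D"
    using assms by (auto simp: acyclic_digraphs_def intro: finite_subset)
  then have "wf D"
    using assms by (auto simp: acyclic_digraphs_def intro: finite_acyclic_wf)
  moreover obtain w where "w \<in> V - set ys" using \<open>set ys \<subset> V\<close> by blast
  \<comment> \<open>A finite acyclic relation is well-founded, so some unlisted vertex is
    \<open>D\<close>-minimal among the unlisted ones; all its in-neighbours are then listed.\<close>
  ultimately obtain v where v: "v \<in> V - set ys" "\<And>u. (u, v) \<in> D \<Longrightarrow> u \<notin> V - set ys"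
    using wfE_min by metis
  then have "parents_listed D v ys"
    using assms(2) by (auto simp: parents_listed_def acyclic_digraphs_def)
  with v(1) show "\<exists>v\<in>V - set ys. parents_listed D v ys" by blast
qed

text \<open>Pigeonhole: more than \<open>length ys\<close> vertices are eligible, so one of them is
  not in \<open>ys\<close>.\<close>

lemma extendable_positions_listed:
  assumes "finite V" "T \<in> position_families V"
  shows "extendable V (positions_listed T)"
  unfolding extendable_def
proof (intro allI impI)
  fix ys assume ys: "distinct ys" "set ys \<subset> V"
  let ?S = "{v \<in> V. T v \<subseteq> {..<length ys}}"
  have "length ys < card V"
    using ys assms(1) by (metis distinct_card psubset_card_mono)
  then have "card (set ys) < card ?S"
    using assms(2) ys by (simp add: position_families_def distinct_card)
  then have "\<not> ?S \<subseteq> set ys" by (meson List.finite_set card_mono not_le)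
  then show "\<exists>v\<in>V - set ys. positions_listed T v ys"
    by (auto simp: positions_listed_def)
qed

text \<open>At the last position, \<open>card V - 1\<close>, all \<open>card V\<close> vertices must
  be eligible. Hence every element of \<open>T v\<close> points to an actual entry of the order, and
  \<open>T v\<close> is finite.\<close>

lemma position_families_bounded:
  assumes "finite V" "T \<in> position_families V" "v \<in> V"
  shows "T v \<subseteq> {..<card V}"
proof -
  let ?k = "card V - 1"
  have "card V > 0" using assms by (auto simp: card_gt_0_iff)
  then have "card V - 1 < card {v \<in> V. T v \<subseteq> {..<?k}}"
    using assms(2) by (auto simp: position_families_def)
  then have "card V \<le> card {v \<in> V. T v \<subseteq> {..<?k}}" by simp
  then have "{v \<in> V. T v \<subseteq> {..<?k}} = V"
    using assms(1) by (intro card_seteq) auto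
  then show ?thesis using assms(3) by force
qed

section \<open>Digraphs and position families along one fixed order\<close>

lemma positions_listed_parent_positions:
  assumes "distinct xs" "set xs = V" "D \<subseteq> V \<times> V" "v \<in> V" "k \<le> length xs"
  shows "positions_listed (parent_positions V xs D) v (take k xs) \<longleftrightarrow>
    parents_listed D v (take k xs)"
proof -
  \<comment> \<open>Distinctness of \<open>xs\<close> makes membership in a prefix a statement about
    positions, so the two eligibility tests agree on every prefix of \<open>xs\<close>.\<close>
  have *: "xs ! j \<in> set (take k xs) \<longleftrightarrow> j < k" if "j < length xs" for j
    using assms(1,5) that by (auto simp: in_set_conv_nth nth_eq_iff_index_eq)
  have "D\<inverse> `` {v} = (!) xs ` {j. j < length xs \<and> (xs ! j, v) \<in> D}"
    using assms(2,3)
    by (auto simp: image_iff in_set_conv_nth Bex_def) (metis SigmaD1 in_set_conv_nth subsetD)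
  then show ?thesis
    using assms(4,5) * by (auto simp: positions_listed_def parents_listed_def parent_positions_def)
qed

lemma digraph_of_parent_positions:
  assumes "set xs = V" "D \<subseteq> V \<times> V"
  shows "digraph_of_positions V xs (parent_positions V xs D) = D"
proof (intro equalityI subsetI)
  fix e assume "e \<in> D"
  obtain u v where e: "e = (u, v)" by (cases e)
  then have "u \<in> set xs" "v \<in> V" using \<open>e \<in> D\<close> assms by auto
  then obtain j where "j < length xs" "u = xs ! j" by (auto simp: in_set_conv_nth)
  then show "e \<in> digraph_of_positions V xs (parent_positions V xs D)"
    using \<open>e \<in> D\<close> \<open>v \<in> V\<close> by (auto simp: e digraph_of_positions_def parent_positions_def)
qed (auto simp: digraph_of_positions_def parent_positions_def)

text \<open>Distinctness lets the tail of an arc determine its position, and the bound on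
  \<open>T v\<close> ensures that the filter \<open>j < length xs\<close> discards nothing.
  Extensionality settles the values outside \<open>V\<close>.\<close>

lemma parent_positions_of_digraph:
  assumes "distinct xs" "T \<in> extensional V" "\<And>v. v \<in> V \<Longrightarrow> T v \<subseteq> {..<length xs}"
  shows "parent_positions V xs (digraph_of_positions V xs T) = T"
proof
  fix v
  show "parent_positions V xs (digraph_of_positions V xs T) v = T v"
  proof (cases "v \<in> V")
    case True
    have "i = j" if "xs ! i = xs ! j" "i < length xs" "j \<in> T v" for i j
      using that assms(1,3) True nth_eq_iff_index_eq by blast
    then show ?thesis
      using assms(3)[OF True] True by (fastforce simp: parent_positions_def digraph_of_positions_def)
  next
    case False
    then show ?thesis using assms(2) by (simp add: parent_positions_def extensional_def)
  qed
qed

section \<open>The bijection between acyclic digraphs and position families\<close>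

lemma parent_positions_in_position_families:
  fixes V :: "'a::linorder set"
  assumes "finite V" "D \<in> acyclic_digraphs V"
  shows "parent_positions V (greedy_order V (parents_listed D)) D \<in> position_families V"
proof -
  define xs where "xs = greedy_order V (parents_listed D)"
  define T where "T = parent_positions V xs D"
  have DV: "D \<subseteq> V \<times> V" using assms(2) by (simp add: acyclic_digraphs_def)
  note xs = greedy_order_props[OF assms(1) extendable_parents_listed[OF assms], folded xs_def]
  have "k < card {v \<in> V. T v \<subseteq> {..<k}}" if k: "k < card V" for k
  proof -
    \<comment> \<open>The vertex at position \<open>j\<close> has all its parents before
      \<open>j\<close>, so the first \<open>k + 1\<close> listed vertices are already eligible at
      position \<open>k\<close>.\<close>
    have "T (xs ! j) \<subseteq> {..<k}" if "j < Suc k" for j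
    proof -
      have j: "j < card V" using that k by simp
      then have "xs ! j \<in> V" using xs(1,3) nth_mem by metis
      then have "positions_listed T (xs ! j) (take j xs)"
        using positions_listed_parent_positions[OF xs(2,3) DV, of "xs ! j" j] xs(1,4) j
        by (simp add: T_def)
      then show ?thesis using that j by (auto simp: positions_listed_def xs(1))
    qed
    moreover have "set (take (Suc k) xs) = (!) xs ` {..<Suc k}"
      using k xs(1) by (simp add: nth_image lessThan_atLeast0)
    moreover have "set (take (Suc k) xs) \<subseteq> V"
      using xs(3) set_take_subset by fastforce
    ultimately have "set (take (Suc k) xs) \<subseteq> {v \<in> V. T v \<subseteq> {..<k}}" by auto
    moreover have "card (set (take (Suc k) xs)) = Suc k"
      using xs(1,2) k by (simp add: distinct_card)
    ultimately show ?thesis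
      using assms(1) card_mono[of "{v \<in> V. T v \<subseteq> {..<k}}" "set (take (Suc k) xs)"] by simp
  qed
  moreover have "T \<in> V \<rightarrow>\<^sub>E UNIV" by (simp add: T_def parent_positions_def)
  ultimately show ?thesis by (simp add: position_families_def T_def xs_def)
qed

text \<open>Both tests agree on all prefixes of the first order, so the second greedy run makes the
  same choices. The order is thus recoverable from the position family alone.\<close>

lemma greedy_order_parent_positions:
  fixes V :: "'a::linorder set"
  assumes "finite V" "D \<in> acyclic_digraphs V"
  shows "greedy_order V (positions_listed
      (parent_positions V (greedy_order V (parents_listed D)) D)) = greedy_order V (parents_listed D)"
proof (rule greedy_order_cong)
  note xs = greedy_order_props[OF assms(1) extendable_parents_listed[OF assms]]
  have DV: "D \<subseteq> V \<times> V" using assms(2) by (simp add: acyclic_digraphs_def)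
  fix k v assume "k < card V" "v \<in> V"
  then show "parents_listed D v (take k (greedy_order V (parents_listed D))) =
    positions_listed (parent_positions V (greedy_order V (parents_listed D)) D) v
      (take k (greedy_order V (parents_listed D)))"
    using positions_listed_parent_positions[OF xs(2,3) DV] xs(1) by simp
qed

text \<open>A vertex listed at position \<open>i\<close> satisfies
  \<open>T v \<subseteq> {..<i}\<close>, so positions strictly increase along arcs and no cycle can
  close.\<close>

lemma digraph_of_positions_in_acyclic_digraphs:
  fixes V :: "'a::linorder set"
  assumes "finite V" "T \<in> position_families V"
  shows "digraph_of_positions V (greedy_order V (positions_listed T)) T \<in> acyclic_digraphs V"
proof -
  define xs where "xs = greedy_order V (positions_listed T)"
  note xs = greedy_order_props[OF assms(1) extendable_positions_listed[OF assms], folded xs_def]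
  define pos where "pos = inv_into {..<card V} ((!) xs)"
  have pos: "pos (xs ! j) = j" if "j < card V" for j
    unfolding pos_def using that xs(1,2)
    by (intro inv_into_f_f) (auto simp: inj_on_def nth_eq_iff_index_eq)
  have arc: "u \<in> V \<and> v \<in> V \<and> pos u < pos v" if "(u, v) \<in> digraph_of_positions V xs T" for u v
  proof -
    obtain j where j: "u = xs ! j" "v \<in> V" "j \<in> T v"
      using \<open>(u, v) \<in> _\<close> by (auto simp: digraph_of_positions_def)
    obtain i where i: "i < card V" "v = xs ! i"
      using j(2) xs(1,3) by (metis in_set_conv_nth)
    have "T v \<subseteq> {..<i}"
      using xs(4)[OF i(1)] i xs(1) by (simp add: positions_listed_def)
    then have "j < i" using j(3) by auto
    moreover have "u \<in> V" using \<open>j < i\<close> i(1) j(1) xs(1,3) nth_mem[of j xs] by simp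
    ultimately show ?thesis using pos i j by simp
  qed
  then have "digraph_of_positions V xs T \<subseteq> inv_image less_than pos" by auto
  then have "wf (digraph_of_positions V xs T)"
    by (rule wf_subset[rotated]) simp
  then show ?thesis
    using arc by (auto simp: acyclic_digraphs_def xs_def wf_acyclic)
qed

text \<open>\<open>T\<close> is the family of parent positions of its own digraph, so the comparison
  of the two tests along one order applies again, in the other direction.\<close>

lemma greedy_order_digraph_of_positions:
  fixes V :: "'a::linorder set"
  assumes "finite V" "T \<in> position_families V"
  shows "greedy_order V (parents_listed
      (digraph_of_positions V (greedy_order V (positions_listed T)) T))
    = greedy_order V (positions_listed T)"
proof (rule greedy_order_cong)
  let ?xs = "greedy_order V (positions_listed T)"
  note xs = greedy_order_props[OF assms(1) extendable_positions_listed[OF assms]]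
  have T: "parent_positions V ?xs (digraph_of_positions V ?xs T) = T"
    using assms(2) position_families_bounded[OF assms] xs(1,2)
    by (intro parent_positions_of_digraph) (auto simp: position_families_def PiE_def)
  have DV: "digraph_of_positions V ?xs T \<subseteq> V \<times> V"
    using digraph_of_positions_in_acyclic_digraphs[OF assms] by (simp add: acyclic_digraphs_def)
  fix k v assume "k < card V" "v \<in> V"
  then show "positions_listed T v (take k ?xs) =
      parents_listed (digraph_of_positions V ?xs T) v (take k ?xs)"
    using positions_listed_parent_positions[OF xs(2,3) DV, of v k] xs(1) by (simp add: T)
qed

text \<open>An arc is encoded by its head and the position of its tail. This makes the bijection
  preserve weights.\<close>

lemma card_digraph_eq_sum_parent_positions:
  assumes "finite V" "distinct xs" "set xs = V" "D \<subseteq> V \<times> V"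
  shows "card D = (\<Sum>v\<in>V. card (parent_positions V xs D v))"
proof -
  let ?P = "parent_positions V xs D"
  have "D = (\<lambda>(v, j). (xs ! j, v)) ` (SIGMA v:V. ?P v)"
    using digraph_of_parent_positions[OF assms(3,4)]
    by (force simp: digraph_of_positions_def)
  moreover have "inj_on (\<lambda>(v, j). (xs ! j, v)) (SIGMA v:V. ?P v)"
    using assms(2) by (auto simp: inj_on_def parent_positions_def nth_eq_iff_index_eq)
  ultimately have "card D = card (SIGMA v:V. ?P v)" by (metis card_image)
  also have "\<dots> = (\<Sum>v\<in>V. card (?P v))"
    using assms(1) by (intro card_SigmaI) (auto simp: parent_positions_def)
  finally show ?thesis .
qed

lemma sum_acyclic_digraphs_eq_sum_position_families:
  fixes V :: "'a::linorder set" and x :: "'b::comm_semiring_1"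
  assumes "finite V"
  shows "(\<Sum>D\<in>acyclic_digraphs V. x ^ card D) =
    (\<Sum>T\<in>position_families V. \<Prod>v\<in>V. x ^ card (T v))"
proof (rule sum.reindex_bij_witness
    [where j = "\<lambda>D. parent_positions V (greedy_order V (parents_listed D)) D"
       and i = "\<lambda>T. digraph_of_positions V (greedy_order V (positions_listed T)) T"])
  fix D assume D: "D \<in> acyclic_digraphs V"
  note xs = greedy_order_props[OF assms extendable_parents_listed[OF assms D]]
  let ?xs = "greedy_order V (parents_listed D)"
  have DV: "D \<subseteq> V \<times> V" using D by (simp add: acyclic_digraphs_def)
  show "parent_positions V ?xs D \<in> position_families V"
    by (rule parent_positions_in_position_families[OF assms D])
  show "digraph_of_positions V
      (greedy_order V (positions_listed (parent_positions V ?xs D))) (parent_positions V ?xs D) = D"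
    by (simp add: greedy_order_parent_positions[OF assms D] digraph_of_parent_positions[OF xs(3) DV])
  show "(\<Prod>v\<in>V. x ^ card (parent_positions V ?xs D v)) = x ^ card D"
    by (simp add: card_digraph_eq_sum_parent_positions[OF assms xs(2,3) DV] power_sum)
next
  fix T assume T: "T \<in> position_families V"
  note xs = greedy_order_props[OF assms extendable_positions_listed[OF assms T]]
  let ?xs = "greedy_order V (positions_listed T)"
  show "digraph_of_positions V ?xs T \<in> acyclic_digraphs V"
    by (rule digraph_of_positions_in_acyclic_digraphs[OF assms T])
  have "parent_positions V ?xs (digraph_of_positions V ?xs T) = T"
    using T position_families_bounded[OF assms T] xs(1,2)
    by (intro parent_positions_of_digraph) (auto simp: position_families_def PiE_def)
  then show "parent_positions V (greedy_order V (parents_listed (digraph_of_positions V ?xs T)))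
      (digraph_of_positions V ?xs T) = T"
    by (simp add: greedy_order_digraph_of_positions[OF assms T])
qed


section \<open>Parking functions\<close>

text \<open>In sorted order the \<open>k + 1\<close> smallest entries are at most \<open>k\<close>.
  Counting entries removes the sorting permutation and matches the form of
  \<open>position_families\<close>.\<close>

lemma mem_parking_functions_iff:
  "a \<in> parking_functions n \<longleftrightarrow>
     a \<in> {1..n} \<rightarrow>\<^sub>E UNIV \<and> (\<forall>k<n. k < card {i \<in> {1..n}. a i \<le> k})"
proof (intro iffI conjI)
  assume a: "a \<in> parking_functions n"
  then show "a \<in> {1..n} \<rightarrow>\<^sub>E UNIV" by (simp add: parking_functions_def)
  \<comment> \<open>The definition speaks of all sorting permutations; it yields information only
    once one is known to exist.\<close>
  obtain \<sigma> where \<sigma>: "\<sigma> permutes {1..n}" "mono_on {1..n} (\<lambda>i. a (\<sigma> i))"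
    using ex_sorting_permutation by blast
  then have le: "a (\<sigma> i) \<le> i - 1" if "i \<in> {1..n}" for i
    using a that unfolding parking_functions_def by blast
  show "\<forall>k<n. k < card {i \<in> {1..n}. a i \<le> k}"
  proof (intro allI impI)
    fix k assume k: "k < n"
    have "a (\<sigma> i) \<le> k" "\<sigma> i \<in> {1..n}" if "i \<in> {1..Suc k}" for i
    proof -
      have i: "i \<in> {1..n}" using that k by auto
      show "\<sigma> i \<in> {1..n}" using permutes_in_image[OF \<sigma>(1)] i by blast
      show "a (\<sigma> i) \<le> k" using le[OF i] that by auto
    qed
    then have "\<sigma> ` {1..Suc k} \<subseteq> {i \<in> {1..n}. a i \<le> k}" by blast
    then have "card (\<sigma> ` {1..Suc k}) \<le> card {i \<in> {1..n}. a i \<le> k}"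
      by (intro card_mono) auto
    moreover have "card (\<sigma> ` {1..Suc k}) = Suc k"
      using permutes_inj_on[OF \<sigma>(1)] by (simp add: card_image)
    ultimately show "k < card {i \<in> {1..n}. a i \<le> k}" by simp
  qed
next
  assume a: "a \<in> {1..n} \<rightarrow>\<^sub>E UNIV \<and> (\<forall>k<n. k < card {i \<in> {1..n}. a i \<le> k})"
  have "a (\<sigma> i) \<le> i - 1"
    if \<sigma>: "\<sigma> permutes {1..n}" "mono_on {1..n} (\<lambda>i. a (\<sigma> i))" and i: "i \<in> {1..n}" for \<sigma> i
  proof (rule ccontr)
    assume gt: "\<not> a (\<sigma> i) \<le> i - 1"
    \<comment> \<open>If the entry at rank \<open>i\<close> exceeds \<open>i - 1\<close>, entries of
      value at most \<open>i - 1\<close> have ranks below \<open>i\<close>. There are at most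
      \<open>i - 1\<close> of them, against the count for \<open>k = i - 1\<close>.\<close>
    have "{j \<in> {1..n}. a j \<le> i - 1} \<subseteq> \<sigma> ` {1..<i}"
    proof
      fix j assume j: "j \<in> {j \<in> {1..n}. a j \<le> i - 1}"
      then have "j \<in> \<sigma> ` {1..n}" by (simp only: permutes_image[OF \<sigma>(1)]) simp
      then obtain l where l: "l \<in> {1..n}" "j = \<sigma> l" by blast
      have "l < i"
      proof (rule ccontr)
        assume "\<not> l < i"
        then have "a (\<sigma> i) \<le> a (\<sigma> l)"
          using mono_onD[OF \<sigma>(2) i l(1)] by simp
        then show False using j l gt by simp
      qed
      then show "j \<in> \<sigma> ` {1..<i}" using l by auto
    qed
    then have "card {j \<in> {1..n}. a j \<le> i - 1} \<le> card (\<sigma> ` {1..<i})"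
      by (intro card_mono) auto
    also have "\<dots> \<le> i - 1" using card_image_le[of "{1..<i}" \<sigma>] by simp
    finally show False using a i
      by (metis atLeastAtMost_iff diff_less less_le_trans linorder_not_le zero_less_one)
  qed
  then show "a \<in> parking_functions n" using a by (simp add: parking_functions_def)
qed

text \<open>The height is \<open>0\<close> for the empty set and one more than the maximum
  otherwise. Stated through inclusions, it needs no case distinction and turns
  \<open>T v \<subseteq> {..<k}\<close> directly into \<open>a v \<le> k\<close>.\<close>

definition sets_of_height :: "nat \<Rightarrow> nat set set" where
  "sets_of_height h = {A. \<forall>k. A \<subseteq> {..<k} \<longleftrightarrow> h \<le> k}"

lemma sets_of_height_0: "sets_of_height 0 = {{}}"
  by (auto simp: sets_of_height_def dest: spec[of _ 0])

text \<open>The maximum \<open>m\<close> is forced and everything below it is free.\<close>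

lemma sets_of_height_Suc: "sets_of_height (Suc m) = insert m ` Pow {..<m}"
proof (intro equalityI subsetI)
  fix A assume "A \<in> sets_of_height (Suc m)"
  then have A: "A \<subseteq> {..<k} \<longleftrightarrow> Suc m \<le> k" for k by (simp add: sets_of_height_def)
  have "A \<subseteq> {..<Suc m}" "\<not> A \<subseteq> {..<m}" using A by auto
  then have "m \<in> A" by (metis lessThan_Suc subset_insert)
  moreover have "A - {m} \<in> Pow {..<m}" using \<open>A \<subseteq> {..<Suc m}\<close> by (auto simp: less_Suc_eq)
  ultimately show "A \<in> insert m ` Pow {..<m}" by (metis image_eqI insert_Diff)
qed (fastforce simp: sets_of_height_def)

lemma finite_sets_of_height: "finite (sets_of_height h)"
  by (cases h) (auto simp: sets_of_height_0 sets_of_height_Suc)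

lemma ex_height: "finite A \<Longrightarrow> \<exists>h. A \<in> sets_of_height h"
proof (cases "A = {}")
  case False
  assume "finite A"
  then have "A \<subseteq> {..<k} \<longleftrightarrow> Suc (Max A) \<le> k" for k
    using False by (auto simp: Suc_le_eq)
  then show ?thesis by (auto simp: sets_of_height_def)
qed (use sets_of_height_0 in blast)

lemma height_unique: "A \<in> sets_of_height h \<Longrightarrow> A \<in> sets_of_height h' \<Longrightarrow> h = h'"
  by (auto simp: sets_of_height_def intro: antisym)

lemma sum_power_card_Pow:
  fixes x :: "'a::comm_semiring_1"
  assumes "finite A"
  shows "(\<Sum>X\<in>Pow A. x ^ card X) = (1 + x) ^ card A"
  using prod_add[OF assms, of "\<lambda>_. x" "\<lambda>_. 1"] by (simp add: add.commute)

text \<open>The forced maximum contributes \<open>x\<close>, and each of the \<open>h - 1\<close>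
  smaller numbers contributes \<open>1 + x\<close> according to whether it is absent or
  present.\<close>

lemma sum_sets_of_height:
  fixes x :: "'a::comm_semiring_1"
  shows "(\<Sum>A\<in>sets_of_height h. x ^ card A) = (if h = 0 then 1 else x * (1 + x) ^ (h - 1))"
proof (cases h)
  case (Suc m)
  have "inj_on (insert m) (Pow {..<m})" by (auto simp: inj_on_def)
  then have "(\<Sum>A\<in>sets_of_height h. x ^ card A) = (\<Sum>X\<in>Pow {..<m}. x ^ card (insert m X))"
    by (simp add: Suc sets_of_height_Suc sum.reindex)
  also have "\<dots> = (\<Sum>X\<in>Pow {..<m}. x * x ^ card X)"
  proof (rule sum.cong)
    fix X assume "X \<in> Pow {..<m}"
    then have "finite X" "m \<notin> X" by (auto intro: finite_subset)
    then show "x ^ card (insert m X) = x * x ^ card X" by simp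
  qed simp
  also have "\<dots> = x * (1 + x) ^ m"
    by (simp add: sum_power_card_Pow flip: sum_distrib_left)
  finally show ?thesis by (simp add: Suc)
qed (simp add: sets_of_height_0)

text \<open>Sort the families by their vector of heights: the eligible vertices at position
  \<open>k\<close> are those of height at most \<open>k\<close>, so the condition on
  \<open>T\<close> is exactly the counting form of parking for the heights.\<close>

lemma position_families_eq_UN_parking_functions:
  "position_families {1..n} = (\<Union>a\<in>parking_functions n. \<Pi>\<^sub>E v\<in>{1..n}. sets_of_height (a v))"
proof -
  have set_eq: "{v \<in> {1..n}. T v \<subseteq> {..<k}} = {v \<in> {1..n}. a v \<le> k}"
    if "\<And>v. v \<in> {1..n} \<Longrightarrow> T v \<in> sets_of_height (a v)" for T a k
    using that by (auto simp: sets_of_height_def)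
  show ?thesis
  proof (intro equalityI subsetI)
    fix T assume T: "T \<in> position_families {1..n}"
    have "\<exists>h. T v \<in> sets_of_height h" if "v \<in> {1..n}" for v
      using position_families_bounded[OF _ T that] by (intro ex_height) (auto intro: finite_subset)
    then obtain b where b: "\<And>v. v \<in> {1..n} \<Longrightarrow> T v \<in> sets_of_height (b v)" by metis
    \<comment> \<open>Heights are chosen only on \<open>{1..n}\<close>; restricting makes the vector
      extensional, as parking functions are.\<close>
    define a where "a = restrict b {1..n}"
    have a: "T v \<in> sets_of_height (a v)" if "v \<in> {1..n}" for v
      using b that by (simp add: a_def)
    have "a \<in> parking_functions n"
      using T set_eq[of T a, OF a]
      by (simp add: mem_parking_functions_iff position_families_def) (simp add: a_def)
    moreover have "T \<in> (\<Pi>\<^sub>E v\<in>{1..n}. sets_of_height (a v))"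
      using T a by (auto simp: position_families_def PiE_def)
    ultimately show "T \<in> (\<Union>a\<in>parking_functions n. \<Pi>\<^sub>E v\<in>{1..n}. sets_of_height (a v))" by blast
  next
    fix T assume "T \<in> (\<Union>a\<in>parking_functions n. \<Pi>\<^sub>E v\<in>{1..n}. sets_of_height (a v))"
    then obtain a where a: "a \<in> parking_functions n" "T \<in> (\<Pi>\<^sub>E v\<in>{1..n}. sets_of_height (a v))"
      by blast
    have *: "T v \<in> sets_of_height (a v)" if "v \<in> {1..n}" for v using a(2) that by (rule PiE_mem)
    show "T \<in> position_families {1..n}"
      using a(1) set_eq[of T a, OF *] PiE_mono[of "{1..n}" "\<lambda>v. sets_of_height (a v)" "\<lambda>_. UNIV"] a(2)
      by (auto simp: position_families_def mem_parking_functions_iff)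
  qed
qed

text \<open>Unique heights make the blocks disjoint. Within a block the sets \<open>T v\<close> vary
  independently, so the sum of products factors into a product of sums.\<close>

lemma sum_position_families_eq_sum_parking_functions:
  fixes x :: "'a::comm_semiring_1"
  shows "(\<Sum>T\<in>position_families {1..n}. \<Prod>v\<in>{1..n}. x ^ card (T v)) =
    (\<Sum>a\<in>parking_functions n. \<Prod>v\<in>{1..n}. if a v = 0 then 1 else x * (1 + x) ^ (a v - 1))"
proof -
  let ?F = "\<lambda>a. \<Pi>\<^sub>E v\<in>{1..n}. sets_of_height (a v)"
  have "?F a \<inter> ?F b = {}" if ab: "a \<in> parking_functions n" "b \<in> parking_functions n" "a \<noteq> b" for a b
  proof (rule ccontr)
    assume "?F a \<inter> ?F b \<noteq> {}"
    then obtain T where "T \<in> ?F a" "T \<in> ?F b" by blast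
    then have "a v = b v" if "v \<in> {1..n}" for v
      using that height_unique by (meson PiE_mem)
    moreover have "a \<in> extensional {1..n}" "b \<in> extensional {1..n}"
      using ab by (auto simp: parking_functions_def PiE_def)
    ultimately show False using ab(3) by (metis extensionalityI)
  qed
  then have "(\<Sum>T\<in>position_families {1..n}. \<Prod>v\<in>{1..n}. x ^ card (T v)) =
      (\<Sum>a\<in>parking_functions n. \<Sum>T\<in>?F a. \<Prod>v\<in>{1..n}. x ^ card (T v))"
    unfolding position_families_eq_UN_parking_functions
    by (intro sum.UNION_disjoint)
       (auto simp: finite_parking_functions finite_sets_of_height intro!: finite_PiE)
  also have "\<dots> = (\<Sum>a\<in>parking_functions n. \<Prod>v\<in>{1..n}. \<Sum>A\<in>sets_of_height (a v). x ^ card A)"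
    by (intro sum.cong refl prod_sum_PiE[symmetric]) (auto simp: finite_sets_of_height)
  finally show ?thesis by (simp add: sum_sets_of_height)
qed


section \<open>The random graph\<close>

definition underlying_edges :: "('a \<times> 'a) set \<Rightarrow> 'a set set" where
  "underlying_edges D = (\<lambda>(u, v). {u, v}) ` D"

lemma acyclic_orientation_edges:
  assumes "D \<in> acyclic_orientations E" "E \<subseteq> all_edges n"
  shows "D \<in> acyclic_digraphs {1..n}" "underlying_edges D = E"
proof -
  have D: "\<And>u v. (u, v) \<in> D \<Longrightarrow> {u, v} \<in> E" "acyclic D"
    "\<And>u v. {u, v} \<in> E \<Longrightarrow> (u, v) \<in> D \<longleftrightarrow> (v, u) \<notin> D"
    using assms(1) by (auto simp: acyclic_orientations_def is_orientation_def)
  have "D \<subseteq> {1..n} \<times> {1..n}"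
  proof
    fix e assume "e \<in> D"
    then have "{fst e, snd e} \<in> E" using D(1)[of "fst e" "snd e"] by simp
    then have "{fst e, snd e} \<in> all_edges n" using assms(2) by (rule subsetD[rotated])
    then show "e \<in> {1..n} \<times> {1..n}" by (cases e) (auto simp: all_edges_def)
  qed
  then show "D \<in> acyclic_digraphs {1..n}" using D(2) by (simp add: acyclic_digraphs_def)
  show "underlying_edges D = E"
  proof (intro equalityI subsetI)
    fix e assume e: "e \<in> E"
    then have "card e = 2" using assms(2) by (auto simp: all_edges_def)
    then obtain u v where uv: "e = {u, v}" by (auto simp: card_2_iff)
    then consider "(u, v) \<in> D" | "(v, u) \<in> D" using D(3) e by blast
    then show "e \<in> underlying_edges D"
      unfolding underlying_edges_def uv by cases (force simp: insert_commute)+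
  qed (auto simp: underlying_edges_def D(1))
qed

lemma acyclic_digraph_antisym:
  assumes "acyclic D" "(u, v) \<in> D"
  shows "u \<noteq> v" "(v, u) \<notin> D"
  using assms by (auto simp: acyclic_def dest: r_into_trancl trancl_into_trancl)

text \<open>Acyclicity forbids loops, so arcs yield two-element edges, and forbids opposite arcs, so
  each edge comes from exactly one arc.\<close>

lemma acyclic_digraph_is_orientation:
  assumes "D \<in> acyclic_digraphs {1..n}"
  shows "underlying_edges D \<subseteq> all_edges n" "D \<in> acyclic_orientations (underlying_edges D)"
    "card (underlying_edges D) = card D"
proof -
  have ac: "acyclic D" and DV: "D \<subseteq> {1..n} \<times> {1..n}"
    using assms by (auto simp: acyclic_digraphs_def)
  note anti = acyclic_digraph_antisym[OF ac]
  show "underlying_edges D \<subseteq> all_edges n"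
    using DV anti(1) by (fastforce simp: underlying_edges_def all_edges_def)
  show "D \<in> acyclic_orientations (underlying_edges D)"
    using ac anti by (force simp: acyclic_orientations_def is_orientation_def underlying_edges_def
        doubleton_eq_iff)
  have "inj_on (\<lambda>(u, v). {u, v}) D"
    using anti by (auto simp: inj_on_def doubleton_eq_iff)
  then show "card (underlying_edges D) = card D"
    by (simp add: underlying_edges_def card_image)
qed

text \<open>Count pairs of a graph and an acyclic orientation of it. The orientation determines the
  graph, so the pairs correspond to acyclic digraphs, with equal numbers of edges and arcs.\<close>

lemma sum_acyclic_orientations:
  fixes f :: "nat \<Rightarrow> 'a::comm_semiring_1"
  shows "(\<Sum>E\<in>Pow (all_edges n). of_nat (card (acyclic_orientations E)) * f (card E)) =
    (\<Sum>D\<in>acyclic_digraphs {1..n}. f (card D))"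
proof -
  have "(\<Sum>E\<in>Pow (all_edges n). of_nat (card (acyclic_orientations E)) * f (card E)) =
      (\<Sum>E\<in>Pow (all_edges n). \<Sum>D\<in>acyclic_orientations E. f (card E))"
    by simp
  also have "\<dots> = (\<Sum>(E, D)\<in>Sigma (Pow (all_edges n)) acyclic_orientations. f (card E))"
    by (intro sum.Sigma) (auto simp: finite_all_edges finite_acyclic_orientations)
  also have "\<dots> = (\<Sum>D\<in>acyclic_digraphs {1..n}. f (card D))"
  proof (rule sum.reindex_bij_witness[where i = "\<lambda>D. (underlying_edges D, D)" and j = snd], goal_cases)
    case (1 x) then show ?case by (auto dest: acyclic_orientation_edges(2))
  next
    case (2 x) then show ?case by (auto simp del: One_nat_def intro: acyclic_orientation_edges(1))
  next
    case (3 D) then show ?case by simp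
  next
    case (4 D) then show ?case using acyclic_digraph_is_orientation(1,2)[of D n] by blast
  next
    case (5 x)
    then obtain E D where "x = (E, D)" "E \<subseteq> all_edges n" "D \<in> acyclic_orientations E" by auto
    then show ?case
      using acyclic_orientation_edges[of D E n] acyclic_digraph_is_orientation(3)[of D n] by auto
  qed
  finally show ?thesis .
qed

section \<open>The expectation as a finite sum over edge sets\<close>

lemma expectation_erdos_renyi:
  fixes f :: "nat set set \<Rightarrow> real"
  assumes "0 \<le> p" "p \<le> 1"
  shows "measure_pmf.expectation (erdos_renyi n p) f =
    (\<Sum>E\<in>Pow (all_edges n). f E * (p ^ card E * (1 - p) ^ (card (all_edges n) - card E)))"
proof -
  let ?A = "all_edges n"
  let ?P = "Pi_pmf ?A False (\<lambda>_. bernoulli_pmf p)"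
  let ?G = "\<lambda>g. {e \<in> ?A. g e}"
  \<comment> \<open>Because the product distribution has default \<open>False\<close> outside
    \<open>?A\<close>, its support lies among the indicator functions of subsets of
    \<open>?A\<close>.\<close>
  let ?S = "(\<lambda>E e. e \<in> E) ` Pow ?A"
  have "measure_pmf.expectation (erdos_renyi n p) f = measure_pmf.expectation ?P (\<lambda>g. f (?G g))"
    by (simp add: erdos_renyi_def)
  also have "\<dots> = (\<Sum>g\<in>?S. f (?G g) * pmf ?P g)"
  proof (rule integral_measure_pmf_real)
    show "finite ?S" by (simp add: finite_all_edges)
    fix g assume "g \<in> set_pmf ?P"
    then have "\<And>e. e \<notin> ?A \<Longrightarrow> \<not> g e"
      using set_Pi_pmf_subset[OF finite_all_edges, of n False "\<lambda>_. bernoulli_pmf p"] by fastforce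
    then have "g = (\<lambda>e. e \<in> ?G g)" by blast
    then show "g \<in> ?S" by (rule image_eqI) simp
  qed
  also have "\<dots> = (\<Sum>E\<in>Pow ?A. f (?G (\<lambda>e. e \<in> E)) * pmf ?P (\<lambda>e. e \<in> E))"
    by (subst sum.reindex) (auto simp: inj_on_def fun_eq_iff)
  also have "\<dots> = (\<Sum>E\<in>Pow ?A. f E * (p ^ card E * (1 - p) ^ (card ?A - card E)))"
  proof (rule sum.cong)
    fix E assume E: "E \<in> Pow ?A"
    then have fin: "finite E" using finite_all_edges finite_subset by auto
    have "pmf ?P (\<lambda>e. e \<in> E) = (\<Prod>e\<in>?A. pmf (bernoulli_pmf p) (e \<in> E))"
      using E by (intro pmf_Pi') (auto simp: finite_all_edges)
    also have "\<dots> = (\<Prod>e\<in>?A. if e \<in> E then p else 1 - p)"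
      using assms by (intro prod.cong) auto
    also have "\<dots> = p ^ card E * (1 - p) ^ (card ?A - card E)"
    proof -
      have "?A \<inter> E = E" "?A \<inter> - E = ?A - E" using E by auto
      then show ?thesis
        using E fin by (simp add: prod.If_cases finite_all_edges card_Diff_subset)
    qed
    moreover have "?G (\<lambda>e. e \<in> E) = E" using E by auto
    ultimately show "f (?G (\<lambda>e. e \<in> E)) * pmf ?P (\<lambda>e. e \<in> E) =
        f E * (p ^ card E * (1 - p) ^ (card ?A - card E))" by simp
  qed simp
  finally show ?thesis .
qed

lemma card_all_edges: "card (all_edges n) = n choose 2"
  using n_subsets[of "{1..n}" 2] by (simp add: all_edges_def)

theorem theorem5p17:
  fixes n :: nat and p q :: real
  assumes "n \<ge> 1" and "0 < p" and "p < 1" and "q = 1 - p"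
  shows "measure_pmf.expectation (erdos_renyi n p) (\<lambda>E. real (card (acyclic_orientations E)))
       = q ^ (n choose 2) *
         (\<Sum>a\<in>parking_functions n. (1 / q) ^ area n a * p ^ card (supp n a))"
proof -
  \<comment> \<open>The odds of an edge: extracting \<open>q ^ N\<close> from the probability of a
    graph leaves one factor \<open>x\<close> per edge.\<close>
  define x where "x = p / q"
  define N where "N = n choose 2"
  have q: "q > 0" using assms by simp
  have x1: "1 + x = 1 / q" using q assms(4) by (simp add: x_def field_simps)
  have "measure_pmf.expectation (erdos_renyi n p) (\<lambda>E. real (card (acyclic_orientations E))) =
      (\<Sum>E\<in>Pow (all_edges n). real (card (acyclic_orientations E)) * (p ^ card E * q ^ (N - card E)))"
    using assms by (simp add: expectation_erdos_renyi card_all_edges N_def)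
  also have "\<dots> = (\<Sum>E\<in>Pow (all_edges n). real (card (acyclic_orientations E)) * (q ^ N * x ^ card E))"
  proof (rule sum.cong)
    fix E assume "E \<in> Pow (all_edges n)"
    \<comment> \<open>This bound keeps the natural-number subtraction \<open>N - card E\<close> from
      truncating.\<close>
    then have "card E \<le> N"
      using card_mono[OF finite_all_edges] by (simp add: N_def flip: card_all_edges)
    then have "p ^ card E * q ^ (N - card E) = q ^ N * x ^ card E"
      using q by (simp add: x_def power_divide power_diff)
    then show "real (card (acyclic_orientations E)) * (p ^ card E * q ^ (N - card E)) =
        real (card (acyclic_orientations E)) * (q ^ N * x ^ card E)" by simp
  qed simp
  also have "\<dots> = q ^ N * (\<Sum>D\<in>acyclic_digraphs {1..n}. x ^ card D)"
    using sum_acyclic_orientations[of "\<lambda>m. q ^ N * x ^ m" n] by (simp add: sum_distrib_left)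
  also have "(\<Sum>D\<in>acyclic_digraphs {1..n}. x ^ card D) =
      (\<Sum>a\<in>parking_functions n. \<Prod>v\<in>{1..n}. if a v = 0 then 1 else x * (1 + x) ^ (a v - 1))"
    by (simp only: sum_acyclic_digraphs_eq_sum_position_families
        sum_position_families_eq_sum_parking_functions finite_atLeastAtMost)
  also have "\<dots> = (\<Sum>a\<in>parking_functions n. (1 / q) ^ area n a * p ^ card (supp n a))"
  proof (rule sum.cong)
    fix a :: "nat \<Rightarrow> nat"
    \<comment> \<open>For \<open>a v = m + 1\<close> the left side is
      \<open>(p / q) * (1 / q) ^ m\<close>, so the factor \<open>p\<close> appears exactly at the
      vertices of the support.\<close>
    have "(if a v = 0 then 1 else x * (1 + x) ^ (a v - 1)) =
        (1 / q) ^ a v * (if a v > 0 then p else 1)" for v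
      by (cases "a v") (simp_all add: x1, simp add: x_def)
    then have "(\<Prod>v\<in>{1..n}. if a v = 0 then 1 else x * (1 + x) ^ (a v - 1)) =
        (\<Prod>v\<in>{1..n}. (1 / q) ^ a v) * (\<Prod>v\<in>{1..n}. if a v > 0 then p else 1)"
      by (simp only: prod.distrib)
    also have "(\<Prod>v\<in>{1..n}. if a v > 0 then p else 1) = p ^ card (supp n a)"
      by (simp add: supp_def flip: prod.inter_filter)
    also have "(\<Prod>v\<in>{1..n}. (1 / q) ^ a v) = (1 / q) ^ area n a"
      by (simp add: area_def power_sum)
    finally show "(\<Prod>v\<in>{1..n}. if a v = 0 then 1 else x * (1 + x) ^ (a v - 1)) =
        (1 / q) ^ area n a * p ^ card (supp n a)" .
  qed simp
  finally show ?thesis by (simp add: N_def)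
qed

end
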